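(* Let $\mathbf{s}$ be a superposition of $k$ geometric sequences, $\mathbf{s}[l]=\sum_{n=1}^{k}a_n r_n^{l}$ for $l=0,1,2,\dots$, with nonzero initial terms $a_1,\dots,a_k\in\mathbb{C}$ and pairwise distinct nonzero common ratios $r_1,\dots,r_k\in\mathbb{C}$, and write $\mathbf{r}=\{r_1,\dots,r_k\}$. Given $k$, the most compact sampling for extracting $\mathbf{r}$ is to take $2k$ consecutive samples of the sequence $\mathbf{s}$.
   Context: Only the superposed sequence $\mathbf{s}$ is observed; the individual $a_n$ and $r_n$ are unknown, while $k$ is assumed known. "Most compact sampling" refers to the minimum number of samples (observed terms of $\mathbf{s}$) for extracting $\mathbf{r}$. "Extracting $\mathbf{r}$" means recovering the common ratios by the following method. Choose indices $\phi_k[0]<\dots<\phi_k[k-1]$ in $\{0,1,2,\dots\}$ and form the vertices $V_j=(\mathbf{s}[\phi_k[0]+j],\dots,\mathbf{s}[\phi_k[k-1]+j])^{\mathrm T}\in\mathbb{C}^k$ for $j=0,1,2,\dots$. From $k+1$ consecutive vertices $V_j,\dots,V_{j+k}$, form the $k+1$ simplexes spanned by the origin and all but one of these vertices. For $l=0,\dots,k$, let $\Lambda_l$ be the signed volume $\frac{1}{k!}\det[\cdot]$ of the simplex obtained by omitting $V_{j+k-l}$ (remaining vertices kept in order), and put $v_l=\Lambda_l/\Lambda_0$. The common ratios are then obtained as the roots $x$ of $\sum_{n=0}^{k}(-1)^{k-n}v_{k-n}x^{n}=0$. *)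

theory Defs
  imports Complex_Main "Jordan_Normal_Form.Determinant"
begin

definition vertex :: "nat \<Rightarrow> (nat \<Rightarrow> complex) \<Rightarrow> (nat \<Rightarrow> nat) \<Rightarrow> nat \<Rightarrow> complex vec" where
  "vertex k s \<phi> j = vec k (\<lambda>i. s (\<phi> i + j))"

text \<open>Signed volume of the simplex in \<open>\<complex>\<^sup>k\<close> spanned by the origin and \<open>k\<close> further vertices.\<close>

definition signed_volume :: "nat \<Rightarrow> complex vec list \<Rightarrow> complex" where
  "signed_volume k vs = det (mat_of_cols k vs) / fact k"

text \<open>\<open>\<Lambda>\<^sub>l\<close>: the vertices with numbers \<open>j, \<dots>, j + k\<close> in order, without number \<open>j + k - l\<close>.
  Meaningful for \<open>l \<le> k\<close> only.\<close>

definition simplex_volume ::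
    "nat \<Rightarrow> (nat \<Rightarrow> complex) \<Rightarrow> (nat \<Rightarrow> nat) \<Rightarrow> nat \<Rightarrow> nat \<Rightarrow> complex" where
  "simplex_volume k s \<phi> j l =
     signed_volume k (map (vertex k s \<phi>) ([j..<j + k - l] @ [j + k - l + 1..<j + k + 1]))"

definition volume_ratio ::
    "nat \<Rightarrow> (nat \<Rightarrow> complex) \<Rightarrow> (nat \<Rightarrow> nat) \<Rightarrow> nat \<Rightarrow> nat \<Rightarrow> complex" where
  "volume_ratio k s \<phi> j l = simplex_volume k s \<phi> j l / simplex_volume k s \<phi> j 0"

definition method_roots ::
    "nat \<Rightarrow> (nat \<Rightarrow> complex) \<Rightarrow> (nat \<Rightarrow> nat) \<Rightarrow> nat \<Rightarrow> complex set" where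
  "method_roots k s \<phi> j =
     {x. (\<Sum>n=0..k. (-1) ^ (k - n) * volume_ratio k s \<phi> j (k - n) * x ^ n) = 0}"

text \<open>Positions of the terms of the sequence that occur as coordinates of the vertices
  number \<open>j, \<dots>, j + k\<close>.\<close>

definition used_indices :: "nat \<Rightarrow> (nat \<Rightarrow> nat) \<Rightarrow> nat \<Rightarrow> nat set" where
  "used_indices k \<phi> j = {\<phi> i + (j + m) | i m. i < k \<and> m \<le> k}"

text \<open>A sampling is the set \<open>S\<close> of positions at which the sequence is observed. It allows
  the extraction of \<open>R\<close> if some run of the method reads only positions in \<open>S\<close>, is
  well-defined (nonzero denominator \<open>\<Lambda>\<^sub>0\<close>), and returns \<open>R\<close>. Only the values of \<open>\<phi>\<close> below
  \<open>k\<close> matter.\<close>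

definition extracts :: "nat \<Rightarrow> (nat \<Rightarrow> complex) \<Rightarrow> complex set \<Rightarrow> nat set \<Rightarrow> bool" where
  "extracts k s R S \<longleftrightarrow>
     (\<exists>\<phi> j. strict_mono_on {..<k} \<phi> \<and> used_indices k \<phi> j \<subseteq> S \<and>
        simplex_volume k s \<phi> j 0 \<noteq> 0 \<and> method_roots k s \<phi> j = R)"

text \<open>Finiteness is required because \<open>card\<close> is \<open>0\<close> on infinite sets.\<close>

definition most_compact_sampling ::
    "nat \<Rightarrow> (nat \<Rightarrow> complex) \<Rightarrow> complex set \<Rightarrow> nat set \<Rightarrow> bool" where
  "most_compact_sampling k s R S \<longleftrightarrow> is_arg_min card (\<lambda>S. finite S \<and> extracts k s R S) S"

end

theory Submission
  imports Defs "HOL-Computational_Algebra.Polynomial"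
begin

text \<open>A window of \<open>2 * k\<close> samples suffices: the polynomial of the method is, up to a scalar, the
  determinant of the \<open>k + 1\<close> vertices bordered below by \<open>(1, x, \<dots>, x ^ k)\<close>. For consecutive \<open>\<phi>\<close> this
  matrix is a nonsingular matrix times the Vandermonde matrix of \<open>r 1, \<dots>, r k, x\<close>, so it is
  singular exactly when \<open>x\<close> is a common ratio. Conversely, the positions read by any run form
  the union of the intervals \<open>{\<phi> i..\<phi> i + k}\<close>, shifted by \<open>j\<close>. This union has at least
  \<open>2 * k\<close> elements, and an additional one as soon as \<open>\<phi>\<close> skips a position.\<close>

section \<open>Vandermonde determinants\<close>

definition vandermonde_mat :: "nat \<Rightarrow> (nat \<Rightarrow> 'a::semiring_1) \<Rightarrow> 'a mat" where
  "vandermonde_mat n y = mat n n (\<lambda>(i, j). y i ^ j)"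

lemma vandermonde_mat_carrier [simp]: "vandermonde_mat n y \<in> carrier_mat n n"
  by (simp add: vandermonde_mat_def)

text \<open>Equal nodes give equal rows. Conversely, a nonzero kernel vector is the coefficient list
  of a nonzero polynomial of degree below \<open>n\<close> that vanishes at every node, so
  \<open>n\<close> distinct nodes are too many roots.\<close>

lemma det_vandermonde_nonzero_iff:
  fixes y :: "nat \<Rightarrow> 'a::idom"
  shows "det (vandermonde_mat n y) \<noteq> 0 \<longleftrightarrow> inj_on y {..<n}"
proof
  assume nz: "det (vandermonde_mat n y) \<noteq> 0"
  show "inj_on y {..<n}"
  proof (rule inj_onI, rule ccontr)
    fix i j assume "i \<in> {..<n}" "j \<in> {..<n}" "y i = y j" "i \<noteq> j"
    moreover from this have "row (vandermonde_mat n y) i = row (vandermonde_mat n y) j"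
      by (intro eq_vecI) (auto simp: vandermonde_mat_def)
    ultimately show False
      using nz det_identical_rows[of "vandermonde_mat n y" n i j] by simp
  qed
next
  assume inj: "inj_on y {..<n}"
  show "det (vandermonde_mat n y) \<noteq> 0"
  proof
    assume "det (vandermonde_mat n y) = 0"
    then obtain v where v: "v \<in> carrier_vec n" "v \<noteq> 0\<^sub>v n" "vandermonde_mat n y *\<^sub>v v = 0\<^sub>v n"
      using det_0_iff_vec_prod_zero[of "vandermonde_mat n y" n] by auto
    define p where "p = (\<Sum>j<n. monom (v $ j) j)"
    have coeff_p: "coeff p j = (if j < n then v $ j else 0)" for j
      by (simp add: p_def coeff_sum if_distrib sum.delta)
    have "poly p (y i) = 0" if "i < n" for i
    proof -
      have "poly p (y i) = (vandermonde_mat n y *\<^sub>v v) $ i"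
        using that v(1)
        by (simp add: p_def poly_sum poly_monom vandermonde_mat_def scalar_prod_def
            mult.commute lessThan_atLeast0)
      then show ?thesis using v(3) that by simp
    qed
    then have "y ` {..<n} \<subseteq> {x. poly p x = 0}" by auto
    moreover have "p \<noteq> 0"
    proof
      assume "p = 0"
      then have "v = 0\<^sub>v n"
        using v(1) coeff_p by (intro eq_vecI) (auto, metis coeff_0)
      with v(2) show False ..
    qed
    ultimately have "n \<le> degree p"
      using card_mono[OF poly_roots_finite, of p "y ` {..<n}"] card_poly_roots_bound[of p]
        card_image[OF inj] by simp
    then have "n = 0 \<or> coeff p (degree p) = 0" by (simp add: coeff_p)
    with \<open>p \<noteq> 0\<close> have "n = 0" by simp
    with v show False by auto
  qed
qed

text \<open>Transposed Vandermonde matrix with weighted columns. It serves as the left factor of the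
  matrices of samples.\<close>

definition power_sum_mat :: "nat \<Rightarrow> (nat \<Rightarrow> 'a::semiring_1) \<Rightarrow> (nat \<Rightarrow> 'a) \<Rightarrow> 'a mat" where
  "power_sum_mat n w y = mat n n (\<lambda>(i, j). w j * y j ^ i)"

lemma power_sum_mat_carrier [simp]: "power_sum_mat n w y \<in> carrier_mat n n"
  by (simp add: power_sum_mat_def)

lemma det_power_sum_mat_nonzero:
  fixes y :: "nat \<Rightarrow> 'a::idom"
  assumes "inj_on y {..<n}" and "\<And>j. j < n \<Longrightarrow> w j \<noteq> 0"
  shows "det (power_sum_mat n w y) \<noteq> 0"
proof -
  define D where "D = mat n n (\<lambda>(i, j). if i = j then w i else 0)"
  have D: "D \<in> carrier_mat n n" "upper_triangular D" by (auto simp: D_def)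
  have "power_sum_mat n w y = transpose_mat (vandermonde_mat n y) * D"
    by (intro eq_matI)
      (auto simp: power_sum_mat_def vandermonde_mat_def D_def scalar_prod_def if_distrib
        cong: if_cong)
  moreover have "det D \<noteq> 0"
    using assms(2) by (simp add: det_upper_triangular[OF D(2,1)] prod_list_diag_prod) (simp add: D_def)
  ultimately show ?thesis
    using assms(1) D(1) det_vandermonde_nonzero_iff[of n y]
    by (simp add: det_mult[of _ n] det_transpose[of _ n])
qed

section \<open>The method polynomial as a determinant\<close>

definition bordered_mat ::
    "nat \<Rightarrow> (nat \<Rightarrow> complex) \<Rightarrow> (nat \<Rightarrow> nat) \<Rightarrow> nat \<Rightarrow> complex \<Rightarrow> complex mat" where
  "bordered_mat k s \<phi> j x =
     mat (Suc k) (Suc k) (\<lambda>(i, n). if i < k then s (\<phi> i + (j + n)) else x ^ n)"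

text \<open>Identifies the minors along the last row with the matrices behind the simplex volumes:
  column \<open>n\<close> holds vertex \<open>j + n\<close>, which is the one omitted for
  \<open>l = k - n\<close>.\<close>

lemma mat_delete_bordered_mat:
  assumes "n \<le> k"
  shows "mat_delete (bordered_mat k s \<phi> j x) k n =
    mat_of_cols k (map (vertex k s \<phi>) ([j..<j + n] @ [j + n + 1..<j + k + 1]))"
proof (rule eq_matI)
  fix i m
  assume *: "i < dim_row (mat_of_cols k (map (vertex k s \<phi>) ([j..<j + n] @ [j + n + 1..<j + k + 1])))"
    "m < dim_col (mat_of_cols k (map (vertex k s \<phi>) ([j..<j + n] @ [j + n + 1..<j + k + 1])))"
  then have "i < k" "m < k" using assms by (auto simp del: upt_Suc)
  then show "mat_delete (bordered_mat k s \<phi> j x) k n $$ (i, m) =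
      mat_of_cols k (map (vertex k s \<phi>) ([j..<j + n] @ [j + n + 1..<j + k + 1])) $$ (i, m)"
    using assms
    by (auto simp: mat_delete_def bordered_mat_def mat_of_cols_index nth_append vertex_def
        simp del: upt_Suc)
qed (use assms in \<open>auto simp: bordered_mat_def simp del: upt_Suc\<close>)

text \<open>Laplace expansion along the row of powers of \<open>x\<close>. The factor
  \<open>fact k\<close> undoes the normalisation of the volumes, and the cofactor sign has exponent
  \<open>k + n\<close>, of the same parity as \<open>k - n\<close>.\<close>

lemma det_bordered_mat:
  "det (bordered_mat k s \<phi> j x) =
     fact k * (\<Sum>n=0..k. (-1) ^ (k - n) * simplex_volume k s \<phi> j (k - n) * x ^ n)"
proof -
  have "bordered_mat k s \<phi> j x \<in> carrier_mat (Suc k) (Suc k)" by (simp add: bordered_mat_def)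
  then have "det (bordered_mat k s \<phi> j x) =
      (\<Sum>n<Suc k. x ^ n * cofactor (bordered_mat k s \<phi> j x) k n)"
    by (subst laplace_expansion_row[of _ "Suc k" k]) (auto simp: bordered_mat_def intro!: sum.cong)
  also have "\<dots> = (\<Sum>n=0..k. fact k * ((-1) ^ (k - n) * simplex_volume k s \<phi> j (k - n) * x ^ n))"
  proof (rule sum.cong)
    fix n assume "n \<in> {0..k}"
    then have n: "n \<le> k" by simp
    have "(-1) ^ (k + n) = ((-1) ^ (k - n) :: complex)"
      using n by (simp add: minus_one_power_iff)
    with n show "x ^ n * cofactor (bordered_mat k s \<phi> j x) k n =
        fact k * ((-1) ^ (k - n) * simplex_volume k s \<phi> j (k - n) * x ^ n)"
      by (simp add: cofactor_def mat_delete_bordered_mat simplex_volume_def signed_volume_def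
          del: upt_Suc)
  qed auto
  finally show ?thesis by (simp add: sum_distrib_left)
qed

lemma method_roots_eq:
  assumes "simplex_volume k s \<phi> j 0 \<noteq> 0"
  shows "method_roots k s \<phi> j = {x. det (bordered_mat k s \<phi> j x) = 0}"
proof -
  have "(\<Sum>n=0..k. (-1) ^ (k - n) * volume_ratio k s \<phi> j (k - n) * x ^ n) =
      (\<Sum>n=0..k. (-1) ^ (k - n) * simplex_volume k s \<phi> j (k - n) * x ^ n)
        / simplex_volume k s \<phi> j 0" for x
    by (simp add: volume_ratio_def sum_divide_distrib)
  then show ?thesis
    using assms by (simp add: method_roots_def det_bordered_mat)
qed

section \<open>Extraction from a window of consecutive samples\<close>

lemma extracts_window:
  fixes a r s :: "nat \<Rightarrow> complex"
  assumes k: "k \<ge> 1"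
    and a: "\<And>n. n \<in> {1..k} \<Longrightarrow> a n \<noteq> 0"
    and r: "\<And>n. n \<in> {1..k} \<Longrightarrow> r n \<noteq> 0"
    and inj: "inj_on r {1..k}"
    and s: "\<And>l. s l = (\<Sum>n=1..k. a n * r n ^ l)"
  shows "extracts k s (r ` {1..k}) {t..<t + 2 * k}"
proof -
  define y where "y n = r (Suc n)" for n
  \<comment> \<open>The start \<open>t\<close> of the window is absorbed into the weights, which
    stay nonzero because the ratios are nonzero.\<close>
  define w where "w n = a (Suc n) * r (Suc n) ^ t" for n
  have s': "s (i + (t + m)) = (\<Sum>n<k. w n * y n ^ i * y n ^ m)" for i m
  proof -
    have "s (i + (t + m)) = (\<Sum>n\<in>Suc ` {..<k}. a n * r n ^ (i + (t + m)))"
      using image_Suc_lessThan[of k] by (simp add: s)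
    then show ?thesis
      by (simp add: sum.reindex y_def w_def power_add mult_ac)
  qed
  have ran: "y ` {..<k} = r ` {1..k}"
    unfolding image_Suc_lessThan[symmetric] image_image y_def ..
  have inj_y: "inj_on y {..<k}"
    using inj unfolding image_Suc_lessThan[symmetric] y_def inj_on_def by auto
  have w: "w n \<noteq> 0" if "n < k" for n using that a r by (simp add: w_def)
  let ?P = "power_sum_mat k w y"
  have detP: "det ?P \<noteq> 0" by (rule det_power_sum_mat_nonzero[OF inj_y w])
  \<comment> \<open>The run takes \<open>id\<close> for the index choice and \<open>t\<close> for
    the first vertex. The empty second list keeps the form of \<open>simplex_volume\<close> at
    \<open>l = 0\<close>.\<close>
  have "mat_of_cols k (map (vertex k s id) ([t..<t + k] @ [t + k + 1..<t + k + 1])) =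
      ?P * vandermonde_mat k y"
    by (intro eq_matI)
      (auto simp: mat_of_cols_index vertex_def s' power_sum_mat_def vandermonde_mat_def
        scalar_prod_def lessThan_atLeast0)
  then have vol: "simplex_volume k s id t 0 \<noteq> 0"
    using detP inj_y det_vandermonde_nonzero_iff[of k y]
    by (simp add: simplex_volume_def signed_volume_def det_mult[of _ k])
  have "det (bordered_mat k s id t x) = 0 \<longleftrightarrow> x \<in> r ` {1..k}" for x
  proof -
    \<comment> \<open>The unknown \<open>x\<close> becomes an additional node. The unit corner of
      \<open>Q\<close> passes its row of powers through unchanged and leaves the determinant of
      \<open>?P\<close> as it is.\<close>
    define z where "z = y(k := x)"
    define Q where "Q = four_block_mat ?P (0\<^sub>m k 1) (0\<^sub>m 1 k) (1\<^sub>m 1)"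
    have Q: "Q \<in> carrier_mat (Suc k) (Suc k)"
      unfolding Q_def using four_block_carrier_mat[of ?P k k "1\<^sub>m 1" 1 1] by simp
    have "det Q = det ?P"
      unfolding Q_def by (subst det_four_block_mat_upper_right_zero_col[of _ k]) auto
    have "bordered_mat k s id t x = Q * vandermonde_mat (Suc k) z" (is "?B = ?QV")
    proof (rule eq_matI)
      fix i m assume "i < dim_row ?QV" "m < dim_col ?QV"
      then have im: "i < Suc k" "m < Suc k" using Q by (auto simp: vandermonde_mat_def)
      then have "?QV $$ (i, m) = (\<Sum>n<Suc k. Q $$ (i, n) * z n ^ m)"
        using Q by (simp add: vandermonde_mat_def scalar_prod_def lessThan_atLeast0)
      also have "\<dots> = ?B $$ (i, m)"
        using im
        by (cases "i < k")
          (auto simp: Q_def z_def bordered_mat_def s' power_sum_mat_def less_Suc_eq)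
      finally show "?B $$ (i, m) = ?QV $$ (i, m)" ..
    qed (use Q in \<open>auto simp: bordered_mat_def vandermonde_mat_def\<close>)
    then have "det ?B = det ?P * det (vandermonde_mat (Suc k) z)"
      using Q \<open>det Q = det ?P\<close> by (simp add: det_mult[of _ "Suc k"])
    then have "det ?B = 0 \<longleftrightarrow> \<not> inj_on z {..<Suc k}"
      using detP det_vandermonde_nonzero_iff[of "Suc k" z] by auto
    also have "inj_on z {..<Suc k} \<longleftrightarrow> x \<notin> y ` {..<k}"
    proof -
      have "inj_on z {..<k}" "z ` {..<k} = y ` {..<k}" "z k = x"
        using inj_y by (auto simp: z_def inj_on_def)
      then show ?thesis by (simp add: lessThan_Suc)
    qed
    finally show ?thesis by (simp only: ran not_not)
  qed
  then have "method_roots k s id t = r ` {1..k}" by (simp add: method_roots_eq[OF vol])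
  moreover have "used_indices k id t \<subseteq> {t..<t + 2 * k}" by (auto simp: used_indices_def)
  moreover have "strict_mono_on {..<k} (id :: nat \<Rightarrow> nat)" by (simp add: strict_mono_on_def)
  ultimately show ?thesis using vol unfolding extracts_def by blast
qed

section \<open>Counting the positions read by a run\<close>

lemma used_indicesI:
  assumes "i < k" "\<phi> i + j \<le> q" "q \<le> \<phi> i + j + k"
  shows "q \<in> used_indices k \<phi> j"
proof -
  obtain m where "q = \<phi> i + j + m" using assms(2) le_Suc_ex by blast
  with assms show ?thesis unfolding used_indices_def by (auto simp: add.assoc)
qed

lemma finite_used_indices: "finite (used_indices k \<phi> j)"
proof -
  have "used_indices k \<phi> j = (\<lambda>(i, m). \<phi> i + (j + m)) ` ({..<k} \<times> {..k})"
    by (auto simp: used_indices_def)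
  then show ?thesis by simp
qed

text \<open>In the grid of pairs \<open>(p, m)\<close> with entry \<open>\<phi> p + j + m\<close>,
  follow the first column down to row \<open>i\<close>, then row \<open>i\<close> to its end, then
  the last column. Entries increase strictly along this path, so it yields
  \<open>(i + 1) + k + (k - 1 - i)\<close> distinct positions. The turning row is left free so that
  it can later be placed at a gap of \<open>\<phi>\<close>.\<close>

lemma staircase_card:
  fixes \<phi> :: "nat \<Rightarrow> nat" and i j k :: nat
  assumes "strict_mono_on {..<k} \<phi>" and "i < k"
  defines "T \<equiv> (\<lambda>p. \<phi> p + j) ` {..i} \<union> {\<phi> i + j<..\<phi> i + j + k} \<union> (\<lambda>p. \<phi> p + j + k) ` {i<..<k}"
  shows "T \<subseteq> used_indices k \<phi> j" and "card T = 2 * k"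
proof -
  note less = strict_mono_onD[OF assms(1)]
  have le: "\<phi> p \<le> \<phi> i" if "p \<le> i" for p
    using less[of p i] that assms(2) by (cases "p = i") auto
  have "\<phi> p + j \<in> used_indices k \<phi> j" if "p \<le> i" for p
    using that assms(2) by (intro used_indicesI[of p]) auto
  moreover have "q \<in> used_indices k \<phi> j" if "q \<in> {\<phi> i + j<..\<phi> i + j + k}" for q
    using that assms(2) by (intro used_indicesI[of i]) auto
  moreover have "\<phi> p + j + k \<in> used_indices k \<phi> j" if "p \<in> {i<..<k}" for p
    using that by (intro used_indicesI[of p]) auto
  ultimately show "T \<subseteq> used_indices k \<phi> j" unfolding T_def by blast
  have inj: "inj_on \<phi> {..<k}" by (rule strict_mono_on_imp_inj_on[OF assms(1)])
  have "card ((\<lambda>p. \<phi> p + j) ` {..i}) = Suc i"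
    using inj assms(2) by (subst card_image) (auto simp: inj_on_def)
  moreover have "card ((\<lambda>p. \<phi> p + j + k) ` {i<..<k}) = k - Suc i"
    using inj assms(2) by (subst card_image) (auto simp: inj_on_def)
  moreover have "(\<lambda>p. \<phi> p + j) ` {..i} \<inter> {\<phi> i + j<..\<phi> i + j + k} = {}"
    using le by fastforce
  moreover have "((\<lambda>p. \<phi> p + j) ` {..i} \<union> {\<phi> i + j<..\<phi> i + j + k}) \<inter>
      (\<lambda>p. \<phi> p + j + k) ` {i<..<k} = {}"
    using le less[of i] assms(2) by fastforce
  ultimately show "card T = 2 * k"
    using assms(2) unfolding T_def by (simp add: card_Un_disjoint)
qed

lemma card_used_indices_ge:
  assumes "strict_mono_on {..<k} \<phi>"
  shows "2 * k \<le> card (used_indices k \<phi> j)"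
proof (cases "k = 0")
  case False
  then show ?thesis
    using staircase_card[OF assms, of 0 j] card_mono[OF finite_used_indices] by (metis gr0I)
qed simp

text \<open>If \<open>\<phi>\<close> skipped a value after \<open>i\<close>, the staircase turning
  at row \<open>i\<close> would miss a position that is read, and the count would exceed
  \<open>2 * k\<close>. Hence \<open>\<phi>\<close> is consecutive.\<close>

lemma used_indices_tight:
  assumes "strict_mono_on {..<k} \<phi>" and "k \<ge> 1" and card: "card (used_indices k \<phi> j) \<le> 2 * k"
  shows "used_indices k \<phi> j = {\<phi> 0 + j..<\<phi> 0 + j + 2 * k}"
proof -
  note less = strict_mono_onD[OF assms(1)]
  have step: "\<phi> (Suc i) = Suc (\<phi> i)" if i: "Suc i < k" for i
  proof (rule ccontr)
    assume "\<phi> (Suc i) \<noteq> Suc (\<phi> i)"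
    with less[of i "Suc i"] i have gap: "\<phi> i + 1 < \<phi> (Suc i)" by simp
    define T where
      "T = (\<lambda>p. \<phi> p + j) ` {..i} \<union> {\<phi> i + j<..\<phi> i + j + k} \<union> (\<lambda>p. \<phi> p + j + k) ` {i<..<k}"
    have T: "T \<subseteq> used_indices k \<phi> j" "card T = 2 * k"
      unfolding T_def using staircase_card[OF assms(1), of i j] i by simp_all
    \<comment> \<open>The gap leaves room for a position strictly between the second and the third part of \<open>T\<close>.\<close>
    define q where "q = \<phi> (Suc i) + j + (k - 1)"
    have "q \<in> used_indices k \<phi> j"
      unfolding q_def using i by (intro used_indicesI[of "Suc i"]) auto
    moreover have "q \<notin> T"
    proof -
      have "\<phi> p \<le> \<phi> i" if "p \<le> i" for p
        using less[of p i] that i by (cases "p = i") auto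
      moreover have "\<phi> (Suc i) \<le> \<phi> p" if "i < p" "p < k" for p
        using less[of "Suc i" p] that i by (cases "p = Suc i") auto
      ultimately show ?thesis using gap assms(2) unfolding T_def q_def by fastforce
    qed
    ultimately have "T \<subset> used_indices k \<phi> j" using T(1) by blast
    then show False
      using psubset_card_mono[OF finite_used_indices, of T k \<phi> j] T(2) card by simp
  qed
  have \<phi>: "\<phi> i = \<phi> 0 + i" if "i < k" for i
    using that by (induction i) (auto simp: step)
  have "used_indices k \<phi> j \<subseteq> {\<phi> 0 + j..<\<phi> 0 + j + 2 * k}"
  proof
    fix q assume "q \<in> used_indices k \<phi> j"
    then obtain i m where "q = \<phi> i + (j + m)" "i < k" "m \<le> k"
      unfolding used_indices_def by blast
    with \<phi>[of i] show "q \<in> {\<phi> 0 + j..<\<phi> 0 + j + 2 * k}"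
      unfolding atLeastLessThan_iff by linarith
  qed
  then show ?thesis
    using card_used_indices_ge[OF assms(1), of j] by (intro card_seteq) auto
qed

theorem corollary2:
  fixes k :: nat and a r s :: "nat \<Rightarrow> complex" and S :: "nat set"
  assumes "k \<ge> 1"
    and "\<And>n. n \<in> {1..k} \<Longrightarrow> a n \<noteq> 0"
    and "\<And>n. n \<in> {1..k} \<Longrightarrow> r n \<noteq> 0"
    and "inj_on r {1..k}"
    and "\<And>l. s l = (\<Sum>n=1..k. a n * r n ^ l)"
  shows "most_compact_sampling k s (r ` {1..k}) S \<longleftrightarrow> (\<exists>t. S = {t..<t + 2 * k})"
proof -
  let ?E = "extracts k s (r ` {1..k})"
  have window: "?E {t..<t + 2 * k}" for t
    by (rule extracts_window) (use assms in auto)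
  have lower: "2 * k \<le> card U" if "finite U" "?E U" for U
    using that card_used_indices_ge card_mono order_trans unfolding extracts_def by metis
  show ?thesis
  proof
    assume "most_compact_sampling k s (r ` {1..k}) S"
    then have S: "finite S" "?E S" "\<And>U. finite U \<Longrightarrow> ?E U \<Longrightarrow> card S \<le> card U"
      unfolding most_compact_sampling_def is_arg_min_def by (auto simp: not_less)
    \<comment> \<open>The window starting at \<open>0\<close> competes with
      \<open>S\<close>.\<close>
    then have card_S: "card S \<le> 2 * k" using S(3)[OF _ window[of 0]] by simp
    obtain \<phi> j where mono: "strict_mono_on {..<k} \<phi>" and sub: "used_indices k \<phi> j \<subseteq> S"
      using S(2) unfolding extracts_def by blast
    \<comment> \<open>The run alone already reads \<open>2 * k\<close> positions, so
      \<open>S\<close> has room for no others.\<close>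
    have "used_indices k \<phi> j = S"
      using card_seteq[OF S(1) sub] card_S card_used_indices_ge[OF mono, of j] by simp
    with used_indices_tight[OF mono assms(1), of j] card_S show "\<exists>t. S = {t..<t + 2 * k}" by auto
  next
    assume "\<exists>t. S = {t..<t + 2 * k}"
    then show "most_compact_sampling k s (r ` {1..k}) S"
      using window lower unfolding most_compact_sampling_def is_arg_min_def
      by (fastforce simp: not_less)
  qed
qed

end
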